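(* Let $X$ be a non-negative integer-valued random variable having a log-concave distribution $p_j=\mathbf{P}\{X=j\}$, $j\in\mathbb{N}_0$, whose probability generating function $f(z)=\sum_{j=0}^\infty p_jz^j$ is entire and satisfies $$0<\lim_{r\to\infty}\frac{\ln f(r)}{\ln^2 r}=:\beta<\infty.$$ Let $a>1$. Then, for $a>\exp\{1/(2\beta)\}$ the distribution of $Y=a^X$ has Stieltjes classes, while for $a<\exp\{1/(2\beta)\}$ there are no Stieltjes classes. In the case $a=\exp\{1/(2\beta)\}$, additional information is needed.
   Context: $\mathbb{N}_0=\{0,1,2,\dots\}$ and $\mathbb{N}=\{1,2,\dots\}$. A discrete distribution $\{p_j\}_{j\in\mathbb{N}_0}$ is log-concave if $p_j^2\geqslant p_{j-1}p_{j+1}$ for all $j\in\mathbb{N}$. For a random variable with a discrete distribution whose probability mass function $p$ is given by $p(x_j)=p_j$, $j\in\mathbb{N}_0$, a sequence $h=\{h_j\}_{j\in\mathbb{N}_0}$ is a perturbation for $p$ if $\sup_j|h_j|=1$ and $\sum_{j=0}^\infty x_j^k p_jh_j=0$ for all $k\in\mathbb{N}_0$. Given a probability mass function $p$ and its perturbation $h$, the set $\{g: g=p(1+\varepsilon h),\ \varepsilon\in[-1,1]\}$ is called a (discrete) Stieltjes class for $p$ generated by $h$. Stieltjes classes of the distribution of $Y=a^X$ are those for its probability mass function $p_Y$, where $x_j=a^j$ and $p_Y(a^j)=p_j$.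
   Formalization: Log-concave here also requires no internal zeros (if p_i and p_k are nonzero, so is every p_j between), and sup|h_j|=1 is taken only over j with p_j nonzero; under the literal definitions the claim fails, e.g. for p_{3i} proportional to exp(-9ci^2), c>0. *)

theory Defs
  imports "HOL-Probability.Probability" "HOL-Complex_Analysis.Complex_Analysis"
begin

definition prob_mass :: "'w measure \<Rightarrow> ('w \<Rightarrow> 'b) \<Rightarrow> 'b \<Rightarrow> real" where
  "prob_mass M X x = measure M {\<omega> \<in> space M. X \<omega> = x}"

(* The second conjunct (no internal zeros) is the usual convention for log-concave sequences.
   It cannot be dropped: any sequence supported on the multiples of 3 satisfies the first
   conjunct, so the inequality alone says nothing about distributions with gaps. *)
definition log_concave :: "(nat \<Rightarrow> real) \<Rightarrow> bool" where
  "log_concave p \<longleftrightarrow>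
     (\<forall>j\<ge>1. (p j)\<^sup>2 \<ge> p (j - 1) * p (j + 1)) \<and>
     (\<forall>i j k. i < j \<and> j < k \<and> p i \<noteq> 0 \<and> p k \<noteq> 0 \<longrightarrow> p j \<noteq> 0)"

definition entire_pgf :: "(nat \<Rightarrow> real) \<Rightarrow> (complex \<Rightarrow> complex) \<Rightarrow> bool" where
  "entire_pgf p f \<longleftrightarrow>
     f holomorphic_on UNIV \<and> (\<forall>z. (\<lambda>j. of_real (p j) * z ^ j) sums f z)"

(* For real r \<ge> 0 the value f(r) is real, so Re only adjusts the type. *)
definition log_concave_rv_with_limit :: "'w measure \<Rightarrow> ('w \<Rightarrow> nat) \<Rightarrow> real \<Rightarrow> bool" where
  "log_concave_rv_with_limit M X \<beta> \<longleftrightarrow>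
     prob_space M \<and> X \<in> measurable M (count_space UNIV) \<and>
     log_concave (prob_mass M X) \<and>
     (\<exists>f. entire_pgf (prob_mass M X) f \<and>
          ((\<lambda>r::real. ln (Re (f (of_real r))) / (ln r)\<^sup>2) \<longlongrightarrow> \<beta>) at_top) \<and>
     0 < \<beta>"

(* x enumerates the possible values and p j is the probability of x j.  The supremum runs over
   the j with p j \<noteq> 0: values of h where p vanishes affect neither the moments nor p(1 + eps h),
   and counting them would make the indicator of a null point a perturbation.  The supremum is
   taken in ereal so that unbounded h are excluded. *)
definition perturbation :: "(nat \<Rightarrow> real) \<Rightarrow> (nat \<Rightarrow> real) \<Rightarrow> (nat \<Rightarrow> real) \<Rightarrow> bool" where
  "perturbation x p h \<longleftrightarrow>
     (SUP j\<in>{j. p j \<noteq> 0}. ereal \<bar>h j\<bar>) = 1 \<and>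
     (\<forall>k::nat. (\<lambda>j. x j ^ k * p j * h j) sums 0)"

(* Mass functions g are represented by the sequences j \<mapsto> g(x j). *)
definition stieltjes_class :: "(nat \<Rightarrow> real) \<Rightarrow> (nat \<Rightarrow> real) \<Rightarrow> (nat \<Rightarrow> real) set \<Rightarrow> bool" where
  "stieltjes_class x p S \<longleftrightarrow>
     (\<exists>h. perturbation x p h \<and>
          S = {g. \<exists>\<epsilon>\<in>{-1..1::real}. g = (\<lambda>j. p j * (1 + \<epsilon> * h j))})"

definition has_stieltjes_classes ::
    "'w measure \<Rightarrow> ('w \<Rightarrow> real) \<Rightarrow> (nat \<Rightarrow> real) \<Rightarrow> bool" where
  "has_stieltjes_classes M Y x \<longleftrightarrow> (\<exists>S. stieltjes_class x (\<lambda>j. prob_mass M Y (x j)) S)"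

end

theory Submission
  imports Defs "HOL-Real_Asymp.Real_Asymp"
begin

text \<open>
  Write \<open>p j = P(X = j)\<close>, \<open>L = ln a\<close> and \<open>F(r) = \<Sum>\<^sub>j p j r ^ j\<close>. With \<open>g = p h\<close>, a
  perturbation is a sequence \<open>g\<close> dominated by a multiple of \<open>p\<close>, not identically zero, whose
  generating function \<open>G(z) = \<Sum>\<^sub>j g j z ^ j\<close> vanishes at all the points \<open>1, a, a\<^sup>2, \<dots>\<close>: the
  \<open>k\<close>-th moment is \<open>\<Sum>\<^sub>j (a ^ j) ^ k g j = G(a ^ k)\<close>. In essence, the slowest growth that a nonzero entire
  function with these zeros can have is that of the Euler product \<open>E(z) = \<Prod>\<^sub>k (1 - z / a ^ k)\<close>, whose
  logarithm grows like \<open>ln\<^sup>2 r / (2 L)\<close>. The generating function of \<open>p\<close> grows like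
  \<open>\<beta> ln\<^sup>2 r\<close>, so everything depends on comparing \<open>\<beta>\<close> with \<open>1 / (2 L)\<close>, that is, \<open>a\<close> with
  \<open>exp (1 / (2 \<beta>))\<close>.

  If \<open>a\<close> is larger, then \<open>p\<close> dominates the coefficients of \<open>E\<close> (shifted to the right, past the
  indices where \<open>p\<close> may vanish), and these give a perturbation. This is where log-concavity enters:
  at the radius \<open>p j / p (j + 1)\<close> the largest term of \<open>F\<close> is the one of index \<open>j\<close>, and so the growth
  of \<open>F\<close> bounds \<open>p j\<close> from below by about \<open>exp (- j\<^sup>2 / (4 \<beta>))\<close>
  (\<open>log_concave_mass_lower_bound\<close>), whereas the coefficients of \<open>E\<close> are of order
  \<open>exp (- L j\<^sup>2 / 2)\<close> (\<open>euler_coeff_bounds\<close>). That \<open>E\<close> vanishes at the powers of \<open>a\<close> follows from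
  \<open>E(a z) = (1 - a z) E(z)\<close>, so no infinite product has to be formed.

  If \<open>a\<close> is smaller, then \<open>G = 0\<close>. Instead of counting zeros with Jensen's formula one can argue
  algebraically: vanishing moments give \<open>\<Sum>\<^sub>j g j Q(a ^ j) = 0\<close> for every polynomial \<open>Q\<close>. If \<open>m\<close> is the first index with
  \<open>g m \<noteq> 0\<close>, choose \<open>Q\<close> with roots \<open>a ^ (m + 1), \<dots>, a ^ (m + n)\<close>. The first term is then
  \<open>g m\<close> times a factor bounded away from \<open>0\<close>, the next \<open>n\<close> terms drop out, and the rest is at most
  \<open>F(a ^ n) / a ^ (n (n + 1) / 2)\<close>, which tends to \<open>0\<close> (\<open>vanishing_moments_imp_zero\<close>).

  If \<open>a = exp (1 / (2 \<beta>))\<close>, the limit \<open>\<beta>\<close> does not decide. The normalised absolute values of the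
  coefficients of \<open>E\<close> are a distribution that has Stieltjes classes, with \<open>h j = (-1) ^ j\<close>. The
  distribution proportional to \<open>a ^ (- j (j + 1) / 2)\<close> decays faster by an exponential factor, and
  this already suffices for the polynomial argument. Both have the same \<open>\<beta>\<close>, since an exponential
  factor is invisible at the scale \<open>ln\<^sup>2 r\<close> (\<open>gaussian_weights_growth\<close>).
\<close>

section \<open>Stieltjes classes and perturbations\<close>

lemma prob_mass_power:
  fixes X :: "'w \<Rightarrow> nat"
  assumes "a > 1"
  shows "prob_mass M (\<lambda>\<omega>. a ^ X \<omega>) (a ^ j :: real) = prob_mass M X j"
  using assms by (simp add: prob_mass_def)

lemma has_stieltjes_classes_power_iff:
  fixes X :: "'w \<Rightarrow> nat" and a :: real
  assumes "a > 1"
  shows "has_stieltjes_classes M (\<lambda>\<omega>. a ^ X \<omega>) (\<lambda>j. a ^ j) \<longleftrightarrow>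
         (\<exists>h. perturbation (\<lambda>j. a ^ j) (prob_mass M X) h)"
  unfolding has_stieltjes_classes_def stieltjes_class_def prob_mass_power[OF assms] by blast

text \<open>
  Dividing by \<open>p\<close> turns a dominated sequence with vanishing moments into a perturbation; the
  supremum of the quotients is finite by domination and is scaled to \<open>1\<close>.
\<close>
lemma perturbation_exists:
  fixes p g :: "nat \<Rightarrow> real"
  assumes nonneg: "\<And>j. p j \<ge> 0"
    and moments: "\<And>k. (\<lambda>j. x j ^ k * g j) sums 0"
    and dominated: "\<And>j. \<bar>g j\<bar> \<le> C * p j"
    and nonzero: "g i \<noteq> 0"
  shows "\<exists>h. perturbation x p h"
proof -
  define A where "A = {j. p j \<noteq> 0}"
  define S where "S = (SUP j\<in>A. \<bar>g j / p j\<bar>)"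
  define h where "h = (\<lambda>j. g j / p j / S)"
  have g0: "g j = 0" if "p j = 0" for j
    using dominated[of j] that by simp
  have iA: "i \<in> A" using g0[of i] nonzero by (auto simp: A_def)
  have ratio: "\<bar>g j / p j\<bar> \<le> C" if "j \<in> A" for j
    using dominated[of j] nonneg[of j] that by (simp add: A_def field_simps)
  have bdd: "bdd_above ((\<lambda>j. \<bar>g j / p j\<bar>) ` A)"
    using ratio by (auto intro!: bdd_aboveI2)
  have le_S: "\<bar>g j / p j\<bar> \<le> S" if "j \<in> A" for j
    unfolding S_def by (rule cSUP_upper[OF that bdd])
  have S_pos: "S > 0"
    using le_S[OF iA] iA nonzero by (simp add: A_def) (smt (verit) divide_pos_pos nonneg)
  have "(SUP j\<in>A. ereal \<bar>h j\<bar>) = 1"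
  proof (rule SUP_eqI)
    fix j assume "j \<in> A"
    then have "\<bar>g j / p j\<bar> / S \<le> 1" using le_S S_pos by (simp only: divide_le_eq_1_pos)
    then show "ereal \<bar>h j\<bar> \<le> 1"
      using S_pos unfolding h_def abs_divide[of _ S] by simp
  next
    fix y assume y: "\<And>j. j \<in> A \<Longrightarrow> ereal \<bar>h j\<bar> \<le> y"
    show "1 \<le> y"
    proof (cases y)
      case (real r)
      have "\<bar>g j / p j\<bar> \<le> r * S" if "j \<in> A" for j
      proof -
        have "\<bar>g j / p j\<bar> / S \<le> r"
          using y[OF that] S_pos unfolding real h_def abs_divide[of _ S] by simp
        then show ?thesis using S_pos by (simp only: pos_divide_le_eq)
      qed
      then have "S \<le> r * S"
        unfolding S_def using iA by (intro cSUP_least) (auto simp: S_def)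
      then show ?thesis using S_pos real by simp
    qed (use y[OF iA] in auto)
  qed
  moreover have "(\<lambda>j. x j ^ k * p j * h j) sums 0" for k
  proof -
    have "(\<lambda>j. x j ^ k * p j * h j) = (\<lambda>j. x j ^ k * g j / S)"
      using g0 by (auto simp: h_def fun_eq_iff)
    then show ?thesis
      using sums_divide[OF moments[of k], of S] by simp
  qed
  ultimately show ?thesis
    unfolding perturbation_def A_def by blast
qed

lemma perturbation_abs_le_1:
  assumes "perturbation x p h" "p j \<noteq> 0"
  shows "\<bar>h j\<bar> \<le> 1"
proof -
  have "ereal \<bar>h j\<bar> \<le> (SUP j\<in>{j. p j \<noteq> 0}. ereal \<bar>h j\<bar>)"
    using assms(2) by (intro SUP_upper) auto
  then show ?thesis using assms(1) by (simp add: perturbation_def)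
qed

lemma perturbation_nonzero:
  assumes "perturbation x p h"
  shows "\<exists>j. p j * h j \<noteq> 0"
proof (rule ccontr)
  assume "\<not> ?thesis"
  then have "(SUP j\<in>{j. p j \<noteq> 0}. ereal \<bar>h j\<bar>) \<le> 0"
    by (intro SUP_least) auto
  then show False using assms by (simp add: perturbation_def)
qed

section \<open>Vanishing moments and small tails\<close>

text \<open>
  The bound must be uniform in \<open>n\<close>: in the critical case the tail decays only exponentially, and
  the trivial bound \<open>(1 - q) ^ n\<close> could decay faster still. The Weierstrass inequality gives it once
  finitely many factors, whose product is a positive constant, have been split off.
\<close>
lemma prod_one_minus_power_bounded_below:
  fixes q :: real
  assumes "0 < q" "q < 1"
  obtains c where "c > 0" "\<And>n. c \<le> (\<Prod>k=1..n. 1 - q ^ k)"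
proof -
  obtain N where N: "q ^ Suc N / (1 - q) < 1 / 2"
  proof -
    have "(\<lambda>N. q ^ Suc N / (1 - q)) \<longlonglongrightarrow> 0"
      using assms by (auto intro!: tendsto_eq_intros LIMSEQ_Suc[OF LIMSEQ_realpow_zero])
    then have "\<forall>\<^sub>F N in sequentially. q ^ Suc N / (1 - q) < 1 / 2"
      by (rule order_tendstoD) simp
    then show ?thesis using that by (auto simp: eventually_sequentially)
  qed
  define P where "P = (\<Prod>k=1..N. 1 - q ^ k)"
  have pos: "1 - q ^ k > 0" if "k \<ge> 1" for k
    using assms that by (simp add: power_less_one_iff)
  have P: "P > 0" unfolding P_def using pos by (intro prod_pos) auto
  \<comment> \<open>The bound is shown for \<open>N + n\<close> factors; dropping the last \<open>N\<close> only enlarges the product.\<close>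
  have "P / 2 \<le> (\<Prod>k=1..n. 1 - q ^ k)" for n
  proof -
    have "(\<Sum>k=Suc N..N+n. q ^ k) \<le> (\<Sum>k. q ^ (k + Suc N))"
    proof -
      have "(\<Sum>k=Suc N..N+n. q ^ k) = (\<Sum>k<n. q ^ (k + Suc N))"
        by (rule sum.reindex_bij_witness[of _ "\<lambda>k. k + Suc N" "\<lambda>k. k - Suc N"]) auto
      also have "\<dots> \<le> (\<Sum>k. q ^ (k + Suc N))"
        using assms by (intro sum_le_suminf summable_ignore_initial_segment summable_geometric) auto
      finally show ?thesis .
    qed
    also have "\<dots> = q ^ Suc N / (1 - q)"
      using assms sums_mult[OF geometric_sums[of q], of "q ^ Suc N"]
      by (intro sums_unique[symmetric]) (simp add: power_add mult_ac)
    finally have "(\<Sum>k=Suc N..N+n. q ^ k) \<le> 1 / 2" using N by linarith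
    moreover have "1 - (\<Sum>k=Suc N..N+n. q ^ k) \<le> (\<Prod>k=Suc N..N+n. 1 - q ^ k)"
      using assms by (intro Weierstrass_prod_ineq) (auto simp: power_le_one)
    ultimately have tail: "1 / 2 \<le> (\<Prod>k=Suc N..N+n. 1 - q ^ k)" by linarith
    have "P * (1 / 2) \<le> P * (\<Prod>k=Suc N..N+n. 1 - q ^ k)"
      using tail P by (intro mult_left_mono) auto
    also have "\<dots> = (\<Prod>k=1..N+n. 1 - q ^ k)"
      unfolding P_def using prod.ub_add_nat[of 1 N "\<lambda>k. 1 - q ^ k" n] by simp
    also have "\<dots> = (\<Prod>k=1..n. 1 - q ^ k) * (\<Prod>k=Suc n..n+N. 1 - q ^ k)"
      using prod.ub_add_nat[of 1 n "\<lambda>k. 1 - q ^ k" N] by (simp add: add.commute)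
    also have "\<dots> \<le> (\<Prod>k=1..n. 1 - q ^ k) * 1"
      using assms pos by (intro mult_left_mono prod_le_1 prod_nonneg)
        (auto intro!: less_imp_le simp: power_le_one)
    finally show ?thesis by simp
  qed
  with P show ?thesis by (intro that[of "P / 2"]) auto
qed

lemma prod_power_atLeastAtMost:
  fixes a :: real
  shows "(\<Prod>k=1..n. a ^ (m + k)) = a ^ (m * n + (Suc n choose 2))"
proof (induction n)
  case (Suc n)
  have "Suc (Suc n) choose 2 = Suc n + (Suc n choose 2)"
    by (simp add: numeral_2_eq_2)
  then show ?case using Suc by (simp add: power_add mult_ac)
qed (simp add: binomial_eq_0)

lemma vanishing_moments_imp_polynomial_zero:
  fixes g x :: "nat \<Rightarrow> real"
  assumes "\<And>k. (\<lambda>j. x j ^ k * g j) sums 0"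
  shows "(\<lambda>j. poly Q (x j) * g j) sums 0"
proof -
  have "(\<lambda>j. \<Sum>i\<le>degree Q. coeff Q i * (x j ^ i * g j)) sums (\<Sum>i\<le>degree Q. coeff Q i * 0)"
    by (intro sums_sum sums_mult assms)
  then show ?thesis by (simp add: poly_altdef sum_distrib_right mult.assoc)
qed

text \<open>
  The annihilating polynomial has its roots at the \<open>n\<close> support points that follow the first index
  \<open>m\<close> with \<open>g m \<noteq> 0\<close>. At \<open>a ^ m\<close> its value is a partial product of \<open>\<Prod>\<^sub>k (1 - a ^ (- k))\<close>, which stays
  away from \<open>0\<close>. At points \<open>a ^ j\<close> beyond the roots each factor is at most \<open>a ^ j / a ^ (m + k)\<close>, which
  produces the triangular exponent \<open>n (n + 1) / 2\<close> in the hypothesis.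
\<close>
lemma vanishing_moments_imp_zero:
  fixes a :: real and g :: "nat \<Rightarrow> real"
  assumes a: "a > 1"
    and moments: "\<And>k. (\<lambda>j. (a ^ j) ^ k * g j) sums 0"
    and abs_summable: "\<And>k. summable (\<lambda>j. (a ^ j) ^ k * \<bar>g j\<bar>)"
    and tail: "(\<lambda>n. (\<Sum>j. (a ^ (j + Suc n)) ^ n * \<bar>g (j + Suc n)\<bar>) / a ^ (Suc n choose 2)) \<longlonglongrightarrow> 0"
  shows "g j = 0"
proof (rule ccontr)
  assume "g j \<noteq> 0"
  define m where "m = (LEAST j. g j \<noteq> 0)"
  have gm: "g m \<noteq> 0" unfolding m_def by (rule LeastI) fact
  have below: "g j = 0" if "j < m" for j
    using not_less_Least that unfolding m_def by blast
  obtain c where c: "c > 0" "\<And>n. c \<le> (\<Prod>k=1..n. 1 - (1 / a) ^ k)"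
    using prod_one_minus_power_bounded_below[of "1 / a"] a by auto
  have "c * \<bar>g m\<bar> \<le> (\<Sum>j. (a ^ (j + Suc n)) ^ n * \<bar>g (j + Suc n)\<bar>) / a ^ (Suc n choose 2)" for n
  proof -
    define Q where "Q = (\<Prod>k=1..n. [:1, - (1 / a ^ (m + k)):])"
    have Q: "poly Q y = (\<Prod>k=1..n. 1 - y / a ^ (m + k))" for y
      by (simp add: Q_def poly_prod)
    \<comment> \<open>\<open>V\<close> is the annihilated series without its leading term, and \<open>U\<close> dominates it.\<close>
    define V where "V = (\<lambda>j. if j = m then 0 else poly Q (a ^ j) * g j)"
    define U where "U = (\<lambda>j. if j \<le> n then 0 else (a ^ j) ^ n * \<bar>g j\<bar> / a ^ (Suc n choose 2))"
    have V_sums: "V sums (- (poly Q (a ^ m) * g m))"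
    proof -
      have "(\<lambda>j. poly Q (a ^ j) * g j - (if j = m then poly Q (a ^ j) * g j else 0)) sums
            (0 - poly Q (a ^ m) * g m)"
        by (intro sums_diff vanishing_moments_imp_polynomial_zero moments sums_single)
      moreover have "(\<lambda>j. poly Q (a ^ j) * g j - (if j = m then poly Q (a ^ j) * g j else 0)) = V"
        by (auto simp: V_def fun_eq_iff)
      ultimately show ?thesis by simp
    qed
    have V_le: "\<bar>V j\<bar> \<le> U j" for j
    proof -
      consider "j \<le> m" | "m < j" "j \<le> m + n" | "m + n < j" by linarith
      then show ?thesis
      proof cases
        case 1
        then show ?thesis using below[of j] a by (auto simp: V_def U_def)
      next
        case 2
        then have "poly Q (a ^ j) = 0"
          unfolding Q using a by (intro prod_zero bexI[of _ "j - m"]) auto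
        then show ?thesis using a by (auto simp: V_def U_def)
      next
        case 3
        have "\<bar>poly Q (a ^ j)\<bar> \<le> (\<Prod>k=1..n. a ^ j / a ^ (m + k))"
          unfolding Q abs_prod
        proof (intro prod_mono conjI)
          fix k assume k: "k \<in> {1..n}"
          then have "a ^ (m + k) \<le> a ^ j" using a 3 by (intro power_increasing) auto
          then have "1 \<le> a ^ j / a ^ (m + k)" using a by simp
          then show "\<bar>1 - a ^ j / a ^ (m + k)\<bar> \<le> a ^ j / a ^ (m + k)" by linarith
        qed auto
        also have "\<dots> = (a ^ j) ^ n / a ^ (m * n + (Suc n choose 2))"
          unfolding prod_dividef prod_power_atLeastAtMost by simp
        also have "\<dots> \<le> (a ^ j) ^ n / a ^ (Suc n choose 2)"
          using a by (intro divide_left_mono power_increasing) auto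
        finally have "\<bar>poly Q (a ^ j)\<bar> * \<bar>g j\<bar> \<le> (a ^ j) ^ n / a ^ (Suc n choose 2) * \<bar>g j\<bar>"
          by (intro mult_right_mono) auto
        then show ?thesis using 3 by (simp add: V_def U_def abs_mult)
      qed
    qed
    have U_sum: "summable U"
      using summable_divide[OF abs_summable[of n], of "a ^ (Suc n choose 2)"]
      by (rule summable_comparison_test'[where N = 0]) (use a in \<open>auto simp: U_def\<close>)
    have "c * \<bar>g m\<bar> \<le> \<bar>poly Q (a ^ m) * g m\<bar>"
    proof -
      have "poly Q (a ^ m) = (\<Prod>k=1..n. 1 - (1 / a) ^ k)"
        unfolding Q using a by (simp add: power_add power_divide)
      then show ?thesis using c(1) c(2)[of n] by (simp add: abs_mult mult_right_mono)
    qed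
    also have "\<dots> = \<bar>\<Sum>j. V j\<bar>" using sums_unique[OF V_sums] by simp
    also have "\<dots> \<le> (\<Sum>j. U j)"
      using norm_suminf_le[of V U] V_le U_sum by simp
    also have "\<dots> = (\<Sum>j. U (j + Suc n))"
      using suminf_split_initial_segment[OF U_sum, of "Suc n"] by (simp add: U_def)
    also have "\<dots> = (\<Sum>j. (a ^ (j + Suc n)) ^ n * \<bar>g (j + Suc n)\<bar>) / a ^ (Suc n choose 2)"
      using suminf_divide[OF summable_ignore_initial_segment[OF abs_summable[of n], of "Suc n"],
          of "a ^ (Suc n choose 2)"]
      by (simp add: U_def)
    finally show ?thesis .
  qed
  then have "c * \<bar>g m\<bar> \<le> 0"
    by (intro LIMSEQ_le_const[OF tail]) auto
  then show False using c gm by (simp add: mult_le_0_iff)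
qed

text \<open>
  The mass itself serves as the dominating sequence, so the criterion is one on \<open>p\<close> alone.
\<close>
lemma no_perturbation_if_small_tail:
  fixes p :: "nat \<Rightarrow> real"
  assumes a: "a > 1" and nonneg: "\<And>j. p j \<ge> 0"
    and summable: "\<And>k. summable (\<lambda>j. (a ^ j) ^ k * p j)"
    and tail: "(\<lambda>n. (\<Sum>j. (a ^ (j + Suc n)) ^ n * p (j + Suc n)) / a ^ (Suc n choose 2)) \<longlonglongrightarrow> 0"
  shows "\<not> perturbation (\<lambda>j. a ^ j) p h"
proof
  assume h: "perturbation (\<lambda>j. a ^ j) p h"
  define g where "g = (\<lambda>j. p j * h j)"
  have g_le: "\<bar>g j\<bar> \<le> p j" for j
    using perturbation_abs_le_1[OF h, of j] nonneg[of j]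
    by (cases "p j = 0") (auto simp: g_def abs_mult mult_left_le)
  have le: "(a ^ j) ^ k * \<bar>g j\<bar> \<le> (a ^ j) ^ k * p j" for j k
    using a g_le by (intro mult_left_mono) auto
  have g_summable: "summable (\<lambda>j. (a ^ j) ^ k * \<bar>g j\<bar>)" for k
    by (rule summable_comparison_test'[OF summable[of k], of 0]) (use le a in simp)
  have "g j = 0" for j
  proof (rule vanishing_moments_imp_zero[OF a _ g_summable])
    show "(\<lambda>j. (a ^ j) ^ k * g j) sums 0" for k
      using h by (simp add: perturbation_def g_def mult.assoc)
    show "(\<lambda>n. (\<Sum>j. (a ^ (j + Suc n)) ^ n * \<bar>g (j + Suc n)\<bar>) / a ^ (Suc n choose 2)) \<longlonglongrightarrow> 0"
    proof (rule tendsto_sandwich[OF _ _ tendsto_const tail])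
      have "(\<Sum>j. (a ^ (j + Suc n)) ^ n * \<bar>g (j + Suc n)\<bar>) \<le>
            (\<Sum>j. (a ^ (j + Suc n)) ^ n * p (j + Suc n))" for n
        by (rule suminf_le[OF le summable_ignore_initial_segment[OF g_summable]
              summable_ignore_initial_segment[OF summable]])
      then show "\<forall>\<^sub>F n in sequentially.
          (\<Sum>j. (a ^ (j + Suc n)) ^ n * \<bar>g (j + Suc n)\<bar>) / a ^ (Suc n choose 2) \<le>
          (\<Sum>j. (a ^ (j + Suc n)) ^ n * p (j + Suc n)) / a ^ (Suc n choose 2)"
        using a by (intro always_eventually allI divide_right_mono) auto
      have "0 \<le> (\<Sum>j. (a ^ (j + Suc n)) ^ n * \<bar>g (j + Suc n)\<bar>)" for n
        by (rule suminf_nonneg[OF summable_ignore_initial_segment[OF g_summable]]) (use a in simp)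
      then show "\<forall>\<^sub>F n in sequentially.
          0 \<le> (\<Sum>j. (a ^ (j + Suc n)) ^ n * \<bar>g (j + Suc n)\<bar>) / a ^ (Suc n choose 2)"
        using a by (intro always_eventually allI divide_nonneg_nonneg) auto
    qed
  qed
  then show False using perturbation_nonzero[OF h] by (simp add: g_def)
qed

section \<open>Log-concave distributions with Gaussian weights\<close>

text \<open>
  Completing the square, with one unit of the linear coefficient set aside to leave a summable
  geometric factor.
\<close>
lemma gaussian_term_le:
  fixes c d :: real
  assumes "c > 0"
  shows "exp (- c * (real j)\<^sup>2 + d * real j) \<le> exp ((d + 1)\<^sup>2 / (4 * c)) * exp (-1) ^ j"
proof -
  have "0 \<le> (2 * c * real j - (d + 1))\<^sup>2 / (4 * c)" using assms by simp
  also have "\<dots> = (d + 1)\<^sup>2 / (4 * c) - (- c * (real j)\<^sup>2 + d * real j) - real j"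
    using assms by (simp add: field_simps power2_eq_square)
  finally have "- c * (real j)\<^sup>2 + d * real j \<le> (d + 1)\<^sup>2 / (4 * c) + real j * (-1)" by simp
  then show ?thesis by (simp only: exp_of_nat_mult[symmetric] exp_add[symmetric] exp_le_cancel_iff)
qed

lemma gaussian_series_bound:
  fixes w :: "nat \<Rightarrow> real"
  assumes c: "c > 0" and w: "\<And>j. \<bar>w j\<bar> \<le> exp (- c * (real j)\<^sup>2 + d * real j)" and r: "r > 0"
  shows "summable (\<lambda>j. \<bar>w j\<bar> * r ^ j)"
    and "(\<Sum>j. \<bar>w j\<bar> * r ^ j) \<le> exp ((d + ln r + 1)\<^sup>2 / (4 * c)) / (1 - exp (-1))"
proof -
  let ?K = "exp ((d + ln r + 1)\<^sup>2 / (4 * c))"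
  have le: "\<bar>w j\<bar> * r ^ j \<le> ?K * exp (-1) ^ j" for j
  proof -
    have "r ^ j = exp (real j * ln r)" using r by (simp add: exp_of_nat_mult)
    then have "\<bar>w j\<bar> * r ^ j \<le> exp (- c * (real j)\<^sup>2 + d * real j) * exp (real j * ln r)"
      using w[of j] by (simp add: mult_right_mono)
    also have "\<dots> = exp (- c * (real j)\<^sup>2 + (d + ln r) * real j)"
      by (simp add: exp_add[symmetric] algebra_simps)
    also have "\<dots> \<le> ?K * exp (-1) ^ j" by (rule gaussian_term_le[OF c])
    finally show ?thesis .
  qed
  have geometric: "(\<lambda>j. ?K * exp (-1) ^ j) sums (?K * (1 / (1 - exp (-1))))"
    by (intro sums_mult geometric_sums) simp
  show summable: "summable (\<lambda>j. \<bar>w j\<bar> * r ^ j)"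
    by (rule summable_comparison_test'[OF sums_summable[OF geometric], of 0])
       (use le r in \<open>auto simp: abs_mult\<close>)
  show "(\<Sum>j. \<bar>w j\<bar> * r ^ j) \<le> ?K / (1 - exp (-1))"
    using suminf_le[OF le summable sums_summable[OF geometric]] sums_unique[OF geometric] by simp
qed

text \<open>
  The terms \<open>w j r ^ j\<close> have logarithm \<open>- L j\<^sup>2 / 2 + j ln r + O(j)\<close>, which is largest near
  \<open>j = ln r / L\<close> with value \<open>ln\<^sup>2 r / (2 L)\<close> up to a term of order \<open>ln r\<close>. The maximal term and the
  whole sum agree at this scale.
\<close>
lemma gaussian_weights_growth:
  fixes w :: "nat \<Rightarrow> real"
  assumes L: "L > 0" and d: "d \<ge> 0" and C: "C > 0"
    and lower: "\<And>j. exp (- (L / 2) * (real j)\<^sup>2 - d * real j) \<le> w j"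
    and upper: "\<And>j. w j \<le> exp (- (L / 2) * (real j)\<^sup>2 + d * real j)"
  shows "((\<lambda>r. ln (C * (\<Sum>j. w j * r ^ j)) / (ln r)\<^sup>2) \<longlongrightarrow> 1 / (2 * L)) at_top"
proof (rule tendsto_sandwich)
  have w_pos: "w j > 0" for j by (rule less_le_trans[OF exp_gt_zero lower])
  have sandwich: "ln C + ((ln r)\<^sup>2 / (2 * L) - L / 2 - d * (ln r / L)) \<le> ln (C * (\<Sum>j. w j * r ^ j)) \<and>
        ln (C * (\<Sum>j. w j * r ^ j)) \<le> ln C + ((d + ln r + 1)\<^sup>2 / (2 * L) - ln (1 - exp (-1)))"
    if r: "r > 1" for r
  proof -
    define t where "t = ln r"
    have t: "t > 0" using r by (simp add: t_def)
    have c: "L / 2 > 0" and r0: "r > 0" using L r by auto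
    have abs_w: "\<bar>w j\<bar> \<le> exp (- (L / 2) * (real j)\<^sup>2 + d * real j)" for j
      using w_pos[of j] upper[of j] by simp
    note series = gaussian_series_bound[OF c abs_w r0]
    define F where "F = (\<Sum>j. w j * r ^ j)"
    have F_upper: "F \<le> exp ((d + t + 1)\<^sup>2 / (2 * L)) / (1 - exp (-1))"
      using series(2) w_pos by (simp add: F_def t_def abs_of_pos)
    \<comment> \<open>The largest term sits near \<open>j = t / L\<close>; rounding down costs at most \<open>L / 2\<close> in the exponent.\<close>
    define j where "j = nat \<lfloor>t / L\<rfloor>"
    have j: "real j \<le> t / L" "t / L - 1 \<le> real j" "0 \<le> t / L"
      using t L by (auto simp: j_def)
    have "exp (t\<^sup>2 / (2 * L) - L / 2 - d * (t / L)) \<le> w j * r ^ j"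
    proof -
      have "(t / L - real j)\<^sup>2 \<le> 1" using j by (auto simp: power_le_one)
      then have "L / 2 * (t / L - real j)\<^sup>2 \<le> L / 2 * 1" using L by (intro mult_left_mono) auto
      moreover have "L / 2 * (t / L - real j)\<^sup>2 = t\<^sup>2 / (2 * L) - real j * t + L / 2 * (real j)\<^sup>2"
        using L by (simp add: field_simps power2_eq_square)
      moreover have "d * real j \<le> d * (t / L)" using d j by (intro mult_left_mono) auto
      ultimately have "t\<^sup>2 / (2 * L) - L / 2 - d * (t / L) \<le>
          (- (L / 2) * (real j)\<^sup>2 - d * real j) + real j * t" by (simp add: algebra_simps)
      then have "exp (t\<^sup>2 / (2 * L) - L / 2 - d * (t / L)) \<le>
          exp (- (L / 2) * (real j)\<^sup>2 - d * real j) * exp (real j * t)"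
        by (simp only: exp_add[symmetric] exp_le_cancel_iff)
      also have "exp (real j * t) = r ^ j" using r by (simp add: t_def exp_of_nat_mult)
      also have "exp (- (L / 2) * (real j)\<^sup>2 - d * real j) * r ^ j \<le> w j * r ^ j"
        using lower r by (intro mult_right_mono) auto
      finally show ?thesis .
    qed
    also have "w j * r ^ j \<le> F"
      unfolding F_def using sum_le_suminf[of "\<lambda>j. w j * r ^ j" "{j}"] series(1) w_pos r
      by (simp add: abs_of_pos less_imp_le)
    finally have F_lower: "exp (t\<^sup>2 / (2 * L) - L / 2 - d * (t / L)) \<le> F" .
    have F_pos: "F > 0" by (rule less_le_trans[OF exp_gt_zero F_lower])
    have "t\<^sup>2 / (2 * L) - L / 2 - d * (t / L) \<le> ln F"
      using F_lower F_pos by (simp add: ln_ge_iff)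
    moreover have "ln F \<le> (d + t + 1)\<^sup>2 / (2 * L) - ln (1 - exp (-1))"
    proof -
      have "ln F \<le> ln (exp ((d + t + 1)\<^sup>2 / (2 * L)) / (1 - exp (-1)))"
        using F_upper F_pos by (subst ln_le_cancel_iff) auto
      then show ?thesis by (simp add: ln_div)
    qed
    ultimately show ?thesis using C F_pos by (simp add: ln_mult F_def t_def)
  qed
  show "\<forall>\<^sub>F r in at_top. (ln C + ((ln r)\<^sup>2 / (2 * L) - L / 2 - d * (ln r / L))) / (ln r)\<^sup>2 \<le>
          ln (C * (\<Sum>j. w j * r ^ j)) / (ln r)\<^sup>2"
    using eventually_gt_at_top[of 1]
  proof eventually_elim
    case (elim r)
    show ?case using sandwich[OF elim] by (intro divide_right_mono) auto
  qed
  show "\<forall>\<^sub>F r in at_top. ln (C * (\<Sum>j. w j * r ^ j)) / (ln r)\<^sup>2 \<le>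
          (ln C + ((d + ln r + 1)\<^sup>2 / (2 * L) - ln (1 - exp (-1)))) / (ln r)\<^sup>2"
    using eventually_gt_at_top[of 1]
  proof eventually_elim
    case (elim r)
    show ?case using sandwich[OF elim] by (intro divide_right_mono) auto
  qed
  show "((\<lambda>r. (ln C + ((ln r)\<^sup>2 / (2 * L) - L / 2 - d * (ln r / L))) / (ln r)\<^sup>2) \<longlongrightarrow> 1 / (2 * L)) at_top"
    using L by real_asymp (simp add: field_simps)
  show "((\<lambda>r. (ln C + ((d + ln r + 1)\<^sup>2 / (2 * L) - ln (1 - exp (-1)))) / (ln r)\<^sup>2) \<longlongrightarrow> 1 / (2 * L)) at_top"
    using L by real_asymp (simp add: field_simps)
qed

lemma log_concave_rv_from_weights:
  fixes w :: "nat \<Rightarrow> real"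
  assumes L: "L > 0" and d: "d \<ge> 0"
    and lower: "\<And>j. exp (- (L / 2) * (real j)\<^sup>2 - d * real j) \<le> w j"
    and upper: "\<And>j. w j \<le> exp (- (L / 2) * (real j)\<^sup>2 + d * real j)"
    and concave: "\<And>j. w j * w (j + 2) \<le> (w (j + 1))\<^sup>2"
  obtains N :: "nat measure" and Z :: "nat \<Rightarrow> nat" and W :: real
  where "W > 0" "log_concave_rv_with_limit N Z (1 / (2 * L))" "prob_mass N Z = (\<lambda>j. w j / W)"
proof -
  have w_pos: "w j > 0" for j by (rule less_le_trans[OF exp_gt_zero lower])
  have abs_w: "\<bar>w j\<bar> \<le> exp (- (L / 2) * (real j)\<^sup>2 + d * real j)" for j
    using w_pos[of j] upper[of j] by simp
  have summable: "summable (\<lambda>j. w j * r ^ j)" if "r > 0" for r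
    using gaussian_series_bound(1)[OF _ abs_w that] L w_pos by (simp add: abs_of_pos)
  have summable_w: "summable w" using summable[of 1] by simp
  define W where "W = suminf w"
  have W: "W > 0" unfolding W_def by (rule suminf_pos[OF summable_w w_pos])
  define p where "p = (\<lambda>j. w j / W)"
  have p_pos: "p j > 0" for j using w_pos[of j] W by (simp add: p_def)
  have "p sums 1"
    using sums_divide[OF summable_sums[OF summable_w], of W] W by (simp add: p_def W_def)
  then have "(\<integral>\<^sup>+j. ennreal (p j) \<partial>count_space UNIV) = 1"
    using p_pos
    by (simp add: nn_integral_count_space_nat suminf_ennreal_eq less_imp_le sums_iff)
  define P where "P = embed_pmf p"
  have pmf_P: "pmf P j = p j" for j
    unfolding P_def by (rule pmf_embed_pmf) (use p_pos \<open>(\<integral>\<^sup>+j. _ \<partial>_) = 1\<close> in \<open>auto simp: less_imp_le\<close>)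
  have mass: "prob_mass (measure_pmf P) (\<lambda>j. j) = p"
    by (simp add: prob_mass_def fun_eq_iff measure_pmf_single pmf_P)
  define f where "f = (\<lambda>z. \<Sum>j. complex_of_real (p j) * z ^ j)"
  have f_sums: "(\<lambda>j. of_real (p j) * z ^ j) sums f z" for z :: complex
  proof -
    have "summable (\<lambda>j. w j * (norm z + 1) ^ j / W)"
      by (intro summable_divide summable) (simp add: add_nonneg_pos)
    then have "summable (\<lambda>j. of_real (p j) * z ^ j)"
      by (rule summable_comparison_test'[where N = 0])
        (use p_pos w_pos W in \<open>auto simp: norm_mult norm_divide norm_power p_def less_imp_le abs_of_pos
           intro!: mult_left_mono divide_right_mono power_mono\<close>)
    then show ?thesis by (simp add: f_def summable_sums)
  qed
  have "f holomorphic_on UNIV"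
  proof -
    have "f holomorphic_on ball 0 r" for r
      by (rule power_series_holomorphic[where a = "\<lambda>j. of_real (p j)"]) (use f_sums in simp)
    then have "f holomorphic_on (\<Union>r. ball 0 r)"
      by (intro holomorphic_on_UN_open) auto
    moreover have "z \<in> (\<Union>r. ball 0 r)" for z :: complex
      by (rule UN_I[of "norm z + 1"]) auto
    then have "(\<Union>r. ball (0::complex) r) = UNIV" by blast
    ultimately show ?thesis by simp
  qed
  then have entire: "entire_pgf p f" using f_sums by (simp add: entire_pgf_def)
  have Re_f: "Re (f (of_real r)) = (1 / W) * (\<Sum>j. w j * r ^ j)" if "r > 0" for r
  proof -
    have "(\<lambda>j. Re (of_real (p j) * of_real r ^ j)) sums Re (f (of_real r))"
      by (rule sums_Re[OF f_sums])
    moreover have "(\<lambda>j. Re (of_real (p j) * of_real r ^ j)) = (\<lambda>j. (1 / W) * (w j * r ^ j))"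
      by (simp add: p_def fun_eq_iff flip: of_real_power of_real_mult)
    ultimately show ?thesis
      using sums_mult[OF summable_sums[OF summable[OF that]], of "1 / W"] sums_unique2 by metis
  qed
  have "((\<lambda>r. ln (Re (f (of_real r))) / (ln r)\<^sup>2) \<longlongrightarrow> 1 / (2 * L)) at_top"
  proof (rule Lim_transform_eventually)
    show "((\<lambda>r. ln ((1 / W) * (\<Sum>j. w j * r ^ j)) / (ln r)\<^sup>2) \<longlongrightarrow> 1 / (2 * L)) at_top"
      using W by (intro gaussian_weights_growth[OF L d _ lower upper]) simp
    show "\<forall>\<^sub>F r in at_top. ln ((1 / W) * (\<Sum>j. w j * r ^ j)) / (ln r)\<^sup>2 =
            ln (Re (f (of_real r))) / (ln r)\<^sup>2"
      using eventually_gt_at_top[of 0] by eventually_elim (simp only: Re_f)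
  qed
  moreover have "log_concave p"
    unfolding log_concave_def
  proof (intro conjI allI impI)
    fix j :: nat assume "1 \<le> j"
    then have "w (j - 1) * w (j + 1) \<le> (w j)\<^sup>2" using concave[of "j - 1"] by simp
    then show "p (j - 1) * p (j + 1) \<le> (p j)\<^sup>2"
      using W by (simp add: p_def power2_eq_square divide_right_mono)
  qed (use p_pos in \<open>simp add: less_imp_neq[symmetric]\<close>)
  ultimately have "log_concave_rv_with_limit (measure_pmf P) (\<lambda>j. j) (1 / (2 * L))"
    unfolding log_concave_rv_with_limit_def mass
    using entire L by (auto intro!: measure_pmf.prob_space_axioms)
  with mass W that show ?thesis unfolding p_def by blast
qed

section \<open>The coefficients of the Euler product\<close>

text \<open>
  The power series coefficients of \<open>\<Prod>\<^sub>k (1 - z / a ^ k)\<close>, \<open>k \<ge> 0\<close>. With \<open>q = 1 / a\<close> this is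
  Euler's \<open>(-1) ^ j q ^ (j (j - 1) / 2) / ((1 - q) \<dots> (1 - q ^ j))\<close>.
\<close>
definition euler_coeff :: "real \<Rightarrow> nat \<Rightarrow> real" where
  "euler_coeff a j = (\<Prod>i=1..j. - a / (a ^ i - 1))"

lemma euler_coeff_0 [simp]: "euler_coeff a 0 = 1"
  by (simp add: euler_coeff_def)

lemma euler_coeff_Suc: "euler_coeff a (Suc j) = - a / (a ^ Suc j - 1) * euler_coeff a j"
  by (simp add: euler_coeff_def)

lemma abs_euler_coeff_Suc:
  assumes "a > 1"
  shows "\<bar>euler_coeff a (Suc j)\<bar> = a / (a ^ Suc j - 1) * \<bar>euler_coeff a j\<bar>"
proof -
  have "a ^ Suc j > 1" using assms by (intro one_less_power) auto
  then show ?thesis using assms by (simp add: euler_coeff_Suc abs_mult abs_divide del: power_Suc)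
qed

lemma exp_ln_power:
  fixes a :: real
  assumes "a > 0"
  shows "a ^ n = exp (ln a * real n)"
  using assms by (simp add: mult.commute exp_of_nat_mult)

text \<open>
  Each factor \<open>a / (a ^ (j + 1) - 1)\<close> lies between \<open>a ^ (- j)\<close> and \<open>a ^ (- j) / (1 - 1 / a)\<close>; multiplying
  up gives \<open>a ^ (- j (j - 1) / 2)\<close> up to an exponential factor. One symmetric constant \<open>d\<close> serves both
  sides, as the weights above require.
\<close>
lemma euler_coeff_bounds:
  assumes "a > 1"
  defines "L \<equiv> ln a" and "d \<equiv> ln a / 2 - ln (1 - 1 / a)"
  shows "exp (- (L / 2) * (real j)\<^sup>2 - d * real j) \<le> \<bar>euler_coeff a j\<bar>"
    and "\<bar>euler_coeff a j\<bar> \<le> exp (- (L / 2) * (real j)\<^sup>2 + d * real j)"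
proof -
  have L: "L > 0" using assms by simp
  have inv: "0 < 1 - 1 / a" "1 - 1 / a < 1" using assms by auto
  then have D: "ln (1 - 1 / a) < 0" by (simp add: ln_less_zero)
  have step: "exp (- L * real j) \<le> a / (a ^ Suc j - 1)"
             "a / (a ^ Suc j - 1) \<le> exp (- L * real j - ln (1 - 1 / a))" for j
  proof -
    have aj: "a ^ j \<ge> 1" using assms by simp
    have gt: "a ^ Suc j > 1" using assms by (intro one_less_power) auto
    have e: "exp (- L * real j) = 1 / a ^ j"
      using assms by (simp add: exp_ln_power exp_minus inverse_eq_divide)
    show "exp (- L * real j) \<le> a / (a ^ Suc j - 1)"
      unfolding e using aj gt assms by (simp add: field_simps)
    have "exp (- L * real j - ln (1 - 1 / a)) = 1 / a ^ j / (1 - 1 / a)"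
      unfolding exp_diff e using inv by simp
    moreover have "a ^ j * (1 - 1 / a) * a \<le> a ^ Suc j - 1"
      using aj assms by (simp add: field_simps)
    then have "a / (a ^ Suc j - 1) \<le> a / (a ^ j * (1 - 1 / a) * a)"
      using inv aj assms gt by (intro divide_left_mono mult_pos_pos) auto
    ultimately show "a / (a ^ Suc j - 1) \<le> exp (- L * real j - ln (1 - 1 / a))"
      using assms by simp
  qed
  have "exp (- (L / 2) * (real j)\<^sup>2 - d * real j) \<le> \<bar>euler_coeff a j\<bar> \<and>
        \<bar>euler_coeff a j\<bar> \<le> exp (- (L / 2) * (real j)\<^sup>2 + d * real j)"
  proof (induction j)
    case (Suc j)
    have "exp (- (L / 2) * (real (Suc j))\<^sup>2 - d * real (Suc j)) \<le>
          exp (- L * real j) * exp (- (L / 2) * (real j)\<^sup>2 - d * real j)"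
      unfolding exp_add[symmetric] exp_le_cancel_iff
      using L D by (simp add: d_def L_def power2_eq_square field_simps)
    also have "\<dots> \<le> \<bar>euler_coeff a (Suc j)\<bar>"
      unfolding abs_euler_coeff_Suc[OF assms(1)] using step(1)[of j] Suc.IH
      by (intro mult_mono) (auto intro: order_trans[OF exp_ge_zero])
    finally have low: "exp (- (L / 2) * (real (Suc j))\<^sup>2 - d * real (Suc j)) \<le> \<bar>euler_coeff a (Suc j)\<bar>" .
    have "\<bar>euler_coeff a (Suc j)\<bar> \<le>
          exp (- L * real j - ln (1 - 1 / a)) * exp (- (L / 2) * (real j)\<^sup>2 + d * real j)"
      unfolding abs_euler_coeff_Suc[OF assms(1)] using step(2)[of j] Suc.IH
      by (intro mult_mono) auto
    also have "\<dots> = exp (- (L / 2) * (real (Suc j))\<^sup>2 + d * real (Suc j))"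
      unfolding exp_add[symmetric]
      by (simp add: d_def L_def power2_eq_square field_simps)
    finally show ?case using low by simp
  qed simp
  then show "exp (- (L / 2) * (real j)\<^sup>2 - d * real j) \<le> \<bar>euler_coeff a j\<bar>"
    and "\<bar>euler_coeff a j\<bar> \<le> exp (- (L / 2) * (real j)\<^sup>2 + d * real j)" by auto
qed

text \<open>
  Convergence at \<open>a z\<close> is part of the conclusion: the recurrence of the coefficients expresses each
  term at \<open>a z\<close> by two terms at \<open>z\<close>.
\<close>
lemma euler_series_functional_equation:
  assumes a: "a > 1" and s: "(\<lambda>j. euler_coeff a j * z ^ j) sums s"
  shows "(\<lambda>j. euler_coeff a j * (a * z) ^ j) sums ((1 - a * z) * s)"
proof -
  define e where "e = euler_coeff a"
  have e: "e 0 = 1" by (simp add: e_def)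
  have "(\<lambda>j. e j * z ^ j) sums (s - 1 + e 0 * z ^ 0)" using s by (simp add: e_def)
  then have tail: "(\<lambda>j. e (Suc j) * z ^ Suc j) sums (s - 1)" by (rule iffD2[OF sums_Suc_iff])
  have "e (Suc j) * (a * z) ^ Suc j = e (Suc j) * z ^ Suc j - a * z * (e j * z ^ j)" for j
  proof -
    have "a ^ Suc j - 1 \<noteq> 0" using one_less_power[OF a, of "Suc j"] by simp
    then have "e (Suc j) * (a ^ Suc j - 1) = - a * e j"
      unfolding e_def by (simp add: euler_coeff_Suc del: power_Suc)
    then have recurrence: "e (Suc j) * a ^ Suc j = e (Suc j) - a * e j"
      unfolding right_diff_distrib by linarith
    have "e (Suc j) * (a * z) ^ Suc j = (e (Suc j) * a ^ Suc j) * z ^ Suc j"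
      by (simp only: power_mult_distrib mult.assoc)
    also have "\<dots> = e (Suc j) * z ^ Suc j - a * z * (e j * z ^ j)"
      unfolding recurrence left_diff_distrib by simp
    finally show ?thesis .
  qed
  then have "(\<lambda>j. e (Suc j) * (a * z) ^ Suc j) sums (s - 1 - a * z * s)"
    using sums_diff[OF tail sums_mult[of "\<lambda>j. e j * z ^ j" s "a * z"]] s
    by (simp only: e_def)
  then have "(\<lambda>j. e j * (a * z) ^ j) sums (s - 1 - a * z * s + e 0 * (a * z) ^ 0)"
    by (rule iffD1[OF sums_Suc_iff])
  moreover have "s - 1 - a * z * s + e 0 * (a * z) ^ 0 = (1 - a * z) * s"
    by (simp add: e left_diff_distrib)
  ultimately show ?thesis by (simp only: e_def)
qed

text \<open>
  The functional equation at \<open>z = 1 / a\<close> has the factor \<open>1 - a z = 0\<close>, and it carries a zero from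
  \<open>a ^ k\<close> to \<open>a ^ (k + 1)\<close>.
\<close>
lemma euler_series_zeros:
  assumes a: "a > 1"
  shows "(\<lambda>j. euler_coeff a j * (a ^ k) ^ j) sums 0"
proof (induction k)
  case 0
  have "summable (\<lambda>j. \<bar>euler_coeff a j\<bar> * (1 / a) ^ j)"
    by (rule gaussian_series_bound(1)[OF _ euler_coeff_bounds(2)[OF a]]) (use a in auto)
  then have "summable (\<lambda>j. euler_coeff a j * (1 / a) ^ j)"
    by (rule summable_comparison_test'[where N = 0]) (use a in \<open>simp add: abs_mult\<close>)
  from euler_series_functional_equation[OF a summable_sums[OF this]]
  show ?case using a by simp
next
  case (Suc k)
  from euler_series_functional_equation[OF a Suc.IH] show ?case by simp
qed

text \<open>
  Shifting the coefficients by \<open>N\<close> multiplies the series by \<open>z ^ N\<close> and keeps its zeros. The shift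
  serves distributions whose mass vanishes at small indices.
\<close>
lemma euler_moments:
  assumes a: "a > 1"
  shows "(\<lambda>j. (a ^ j) ^ k * (if j < N then 0 else euler_coeff a (j - N))) sums 0"
proof -
  define c where "c = (\<lambda>j. (a ^ j) ^ k * (if j < N then 0 else euler_coeff a (j - N)))"
  have "c (j + N) = (a ^ N) ^ k * (euler_coeff a j * (a ^ k) ^ j)" for j
  proof -
    have "(a ^ j) ^ k = (a ^ k) ^ j" by (simp only: power_mult[symmetric] mult.commute)
    then show ?thesis by (simp add: c_def power_add power_mult_distrib)
  qed
  then have "(\<lambda>j. c (j + N)) sums 0"
    using sums_mult[OF euler_series_zeros[OF a, of k], of "(a ^ N) ^ k"] by simp
  moreover have "(\<Sum>j<N. c j) = 0" by (rule sum.neutral) (simp add: c_def)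
  ultimately have "c sums 0" using sums_iff_shift[of c N 0] by simp
  then show ?thesis by (simp only: c_def)
qed

section \<open>Mass bounds from the growth of the generating function\<close>

text \<open>
  Since \<open>ln 0 = 0\<close>, a positive value of \<open>ln (F r)\<close> together with \<open>F r \<ge> 0\<close> forces \<open>F r > 0\<close>.
\<close>
lemma pgf_growth_lower:
  fixes F :: "real \<Rightarrow> real"
  assumes nonneg: "\<And>r. r \<ge> 0 \<Longrightarrow> F r \<ge> 0"
    and lim: "((\<lambda>r. ln (F r) / (ln r)\<^sup>2) \<longlongrightarrow> \<beta>) at_top"
    and b: "0 < b" "b < \<beta>"
  shows "\<forall>\<^sub>F r in at_top. exp (b * (ln r)\<^sup>2) \<le> F r"
  using order_tendstoD(1)[OF lim b(2)] eventually_gt_at_top[of 1]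
proof eventually_elim
  case (elim r)
  have "(ln r)\<^sup>2 > 0" using elim(2) by simp
  then have less: "b * (ln r)\<^sup>2 < ln (F r)" using elim(1) by (simp add: field_simps)
  then have "ln (F r) > 0" using b(1) by (smt (verit) mult_nonneg_nonneg zero_le_power2)
  then have "F r > 0" using nonneg[of r] elim(2) by (cases "F r = 0") auto
  then show ?case using less by (simp add: ln_ge_iff[symmetric])
qed

lemma pgf_growth_upper:
  fixes F :: "real \<Rightarrow> real"
  assumes lim: "((\<lambda>r. ln (F r) / (ln r)\<^sup>2) \<longlongrightarrow> \<beta>) at_top" and b: "\<beta> < b"
  shows "\<forall>\<^sub>F r in at_top. F r \<le> exp (b * (ln r)\<^sup>2)"
  using order_tendstoD(2)[OF lim b] eventually_gt_at_top[of 1]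
proof eventually_elim
  case (elim r)
  have "(ln r)\<^sup>2 > 0" using elim(2) by simp
  then have less: "ln (F r) < b * (ln r)\<^sup>2" using elim(1) by (simp add: field_simps)
  show ?case
  proof (cases "F r > 0")
    case True
    then have "F r = exp (ln (F r))" by simp
    also have "\<dots> \<le> exp (b * (ln r)\<^sup>2)" using less by simp
    finally show ?thesis .
  qed (smt (verit) exp_gt_zero)
qed

text \<open>
  Otherwise \<open>F\<close> would be a polynomial, which grows more slowly than \<open>exp (b ln\<^sup>2 r)\<close>.
\<close>
lemma growth_imp_unbounded_support:
  fixes p :: "nat \<Rightarrow> real"
  assumes nonneg: "\<And>j. p j \<ge> 0" and sums: "\<And>r. (\<lambda>j. p j * r ^ j) sums F r"
    and b: "b > 0" and growth: "\<forall>\<^sub>F r in at_top. exp (b * (ln r)\<^sup>2) \<le> F r"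
  shows "\<exists>j>n. p j \<noteq> 0"
proof (rule ccontr)
  assume no: "\<not> ?thesis"
  have zero: "p j = 0" if "j > n" for j using no that by blast
  have le: "F r \<le> r ^ n * F 1" if "r \<ge> 1" for r
  proof -
    have "p j * r ^ j \<le> r ^ n * (p j * 1 ^ j)" for j
    proof (cases "j > n")
      case False
      then have "p j * r ^ j \<le> p j * r ^ n"
        using that nonneg by (intro mult_left_mono power_increasing) auto
      then show ?thesis by (simp add: mult.commute)
    qed (simp add: zero)
    then show ?thesis using sums_le[OF _ sums sums_mult[OF sums]] by blast
  qed
  have "\<forall>\<^sub>F r in at_top. real n * ln r + F 1 < b * (ln r)\<^sup>2"
    using b by real_asymp
  then have "\<forall>\<^sub>F r::real in at_top. False"
    using growth eventually_ge_at_top[of 1]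
  proof eventually_elim
    case (elim r)
    have "F r \<le> r ^ n * exp (F 1)"
      using le[of r] elim(3) exp_ge_add_one_self[of "F 1"]
      by (meson add_increasing less_eq_real_def mult_left_mono order_trans zero_le_one zero_le_power)
    also have "\<dots> = exp (real n * ln r + F 1)"
      using elim(3) by (simp add: exp_add exp_of_nat_mult)
    also have "\<dots> < exp (b * (ln r)\<^sup>2)" using elim(1) by simp
    finally show False using elim(2) by simp
  qed
  then show False by simp
qed

text \<open>
  For a log-concave sequence the ratios \<open>p j / p (j + 1)\<close> increase, so every index \<open>j\<close> in the support is
  the index of a largest term of the series at some radius, and a largest term is comparable with the
  sum at half that radius. The growth of \<open>F\<close> there, minimised over the unknown radius, bounds \<open>p j\<close>.
\<close>
lemma log_concave_mass_lower_bound: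
  fixes p :: "nat \<Rightarrow> real"
  assumes nonneg: "\<And>j. p j \<ge> 0" and sums: "\<And>r. (\<lambda>j. p j * r ^ j) sums F r"
    and concave: "log_concave p"
    and b: "b > 0" and growth: "\<forall>\<^sub>F r in at_top. exp (b * (ln r)\<^sup>2) \<le> F r"
  shows "\<exists>N. \<forall>j\<ge>N. exp (- (real j)\<^sup>2 / (4 * b) - ln 2 * real j) / 2 \<le> p j"
proof -
  note unbounded = growth_imp_unbounded_support[OF nonneg sums b growth]
  define i where "i = (LEAST j. p j \<noteq> 0)"
  have pi: "p i \<noteq> 0"
    using unbounded[of 0] unfolding i_def by (metis (mono_tags, lifting) LeastI)
  have below: "p j = 0" if "j < i" for j
    using not_less_Least that unfolding i_def by blast
  have pos: "p j > 0" if "j \<ge> i" for j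
  proof -
    obtain k where "k > j" "p k \<noteq> 0" using unbounded by blast
    then have "p j \<noteq> 0"
      using concave pi that unfolding log_concave_def by (metis le_neq_implies_less)
    then show ?thesis using nonneg[of j] by simp
  qed
  define \<rho> where "\<rho> = (\<lambda>j. p j / p (Suc j))"
  have \<rho>_Suc: "\<rho> j \<le> \<rho> (Suc j)" if "j \<ge> i" for j
  proof -
    have "p j * p (Suc (Suc j)) \<le> (p (Suc j))\<^sup>2"
      using concave unfolding log_concave_def by (metis Suc_eq_plus1 add_diff_cancel_right' le_add2)
    then show ?thesis
      using pos[of "Suc j"] pos[of "Suc (Suc j)"] that
      by (simp add: \<rho>_def field_simps power2_eq_square)
  qed
  have \<rho>_mono: "\<rho> j \<le> \<rho> k" if "i \<le> j" "j \<le> k" for j k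
    using that(2) by (induction k rule: dec_induct) (use that(1) \<rho>_Suc in \<open>auto intro: order_trans\<close>)
  have \<rho>_pos: "\<rho> j > 0" if "j \<ge> i" for j
    using pos[of j] pos[of "Suc j"] that by (simp add: \<rho>_def)
  \<comment> \<open>At the radius \<open>\<rho> j\<close> the terms of the series increase up to index \<open>j\<close> and decrease after it.\<close>
  have max_term: "p k * \<rho> j ^ k \<le> p j * \<rho> j ^ j" if "j \<ge> i" for j k
  proof (cases "j \<le> k")
    case True
    then show ?thesis
    proof (induction k rule: dec_induct)
      case (step k)
      have "\<rho> j \<le> p k / p (Suc k)" using \<rho>_mono[OF that step.hyps(1)] by (simp add: \<rho>_def)
      then have "p (Suc k) * \<rho> j \<le> p k"
        using pos[of "Suc k"] that step.hyps(1) by (simp add: field_simps)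
      then have "p (Suc k) * \<rho> j * \<rho> j ^ k \<le> p k * \<rho> j ^ k"
        using \<rho>_pos[OF that] by (intro mult_right_mono) auto
      then show ?case using step.IH by (simp add: mult_ac)
    qed simp
  next
    case False
    then have "k \<le> j" by simp
    then show ?thesis
    proof (induction k rule: inc_induct)
      case (step k)
      have "p k \<le> p (Suc k) * \<rho> j"
      proof (cases "k < i")
        case True
        then show ?thesis using below \<rho>_pos[OF that] nonneg by simp
      next
        case False
        then have "p k / p (Suc k) \<le> \<rho> j" using \<rho>_mono[of k j] step.hyps by (simp add: \<rho>_def)
        then show ?thesis using pos[of "Suc k"] False by (simp add: field_simps)
      qed
      then have "p k * \<rho> j ^ k \<le> p (Suc k) * \<rho> j * \<rho> j ^ k"
        using \<rho>_pos[OF that] by (intro mult_right_mono) auto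
      then show ?case using step.IH by (simp add: mult_ac)
    qed simp
  qed
  have \<rho>_unbounded: "\<exists>j\<ge>i. R \<le> \<rho> j" if R: "R > 0" for R
  proof (rule ccontr)
    assume "\<not> ?thesis"
    then have less: "\<rho> j < R" if "j \<ge> i" for j using that by force
    have "p i * R ^ i \<le> p k * R ^ k" if "i \<le> k" for k
      using that
    proof (induction k rule: dec_induct)
      case (step k)
      have "p k / p (Suc k) \<le> R" using less[OF step.hyps(1)] by (simp add: \<rho>_def)
      then have "p k \<le> p (Suc k) * R"
        using pos[of "Suc k"] step.hyps(1) by (simp add: field_simps)
      then have "p k * R ^ k \<le> p (Suc k) * R * R ^ k" using R by (intro mult_right_mono) auto
      then show ?case using step.IH by (simp add: mult_ac)
    qed simp
    moreover have "(\<lambda>k. p k * R ^ k) \<longlonglongrightarrow> 0"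
      by (rule summable_LIMSEQ_zero[OF sums_summable[OF sums]])
    ultimately have "p i * R ^ i \<le> 0"
      using LIMSEQ_le_const by blast
    moreover have "p i * R ^ i > 0" using pos[of i] R by simp
    ultimately show False by simp
  qed
  obtain R\<^sub>0 where R\<^sub>0: "\<And>r. r \<ge> R\<^sub>0 \<Longrightarrow> exp (b * (ln r)\<^sup>2) \<le> F r"
    using growth by (auto simp: eventually_at_top_linorder)
  obtain N where N: "N \<ge> i" "2 * max R\<^sub>0 1 \<le> \<rho> N"
    using \<rho>_unbounded[of "2 * max R\<^sub>0 1"] by auto
  have "exp (- (real j)\<^sup>2 / (4 * b) - ln 2 * real j) / 2 \<le> p j" if "j \<ge> N" for j
  proof -
    have ji: "j \<ge> i" using N that by simp
    define s where "s = ln (\<rho> j / 2)"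
    have big: "\<rho> j / 2 \<ge> max R\<^sub>0 1" using N \<rho>_mono[OF N(1) that] by simp
    have \<rho>_exp: "\<rho> j = exp (ln 2 + s)" using \<rho>_pos[OF ji] by (simp add: s_def exp_add)
    have "exp (b * s\<^sup>2) \<le> F (\<rho> j / 2)" using R\<^sub>0 big by (simp add: s_def)
    \<comment> \<open>Halving the radius turns domination by the largest term into a geometric bound on the sum.\<close>
    also have "F (\<rho> j / 2) \<le> p j * \<rho> j ^ j * 2"
    proof (rule sums_le[OF _ sums])
      show "(\<lambda>k. p j * \<rho> j ^ j * (1 / 2) ^ k) sums (p j * \<rho> j ^ j * 2)"
        using sums_mult[OF geometric_sums[of "1 / 2 :: real"], of "p j * \<rho> j ^ j"] by simp
      show "p k * (\<rho> j / 2) ^ k \<le> p j * \<rho> j ^ j * (1 / 2) ^ k" for k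
        using mult_right_mono[OF max_term[OF ji, of k], of "(1 / 2) ^ k"]
        by (simp add: power_divide)
    qed
    also have "\<rho> j ^ j = exp (real j * (ln 2 + s))"
      unfolding \<rho>_exp by (simp only: exp_of_nat_mult)
    finally have "exp (b * s\<^sup>2) \<le> (p j * 2) * exp (real j * (ln 2 + s))"
      by (simp only: mult_ac)
    then have "exp (b * s\<^sup>2 - real j * (ln 2 + s)) \<le> p j * 2"
      unfolding exp_diff by (simp only: pos_divide_le_eq exp_gt_zero)
    moreover have "- (real j)\<^sup>2 / (4 * b) - ln 2 * real j \<le> b * s\<^sup>2 - real j * (ln 2 + s)"
    proof -
      have "0 \<le> (2 * b * s - real j)\<^sup>2 / (4 * b)" using b by simp
      also have "\<dots> = b * s\<^sup>2 - real j * s + (real j)\<^sup>2 / (4 * b)"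
        using b by (simp add: field_simps power2_eq_square)
      finally show ?thesis by (simp add: algebra_simps)
    qed
    ultimately have "exp (- (real j)\<^sup>2 / (4 * b) - ln 2 * real j) \<le> p j * 2"
      using exp_le_cancel_iff order_trans by blast
    then show ?thesis by simp
  qed
  then show ?thesis by blast
qed

section \<open>The three regimes\<close>

lemma log_concave_rv_with_limit_pgf:
  assumes "log_concave_rv_with_limit M X \<beta>"
  obtains F where "\<And>r. (\<lambda>j. prob_mass M X j * r ^ j) sums F r"
    and "((\<lambda>r. ln (F r) / (ln r)\<^sup>2) \<longlongrightarrow> \<beta>) at_top"
proof -
  obtain f where f: "entire_pgf (prob_mass M X) f"
    and lim: "((\<lambda>r::real. ln (Re (f (of_real r))) / (ln r)\<^sup>2) \<longlongrightarrow> \<beta>) at_top"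
    using assms by (auto simp: log_concave_rv_with_limit_def)
  have "(\<lambda>j. prob_mass M X j * r ^ j) sums Re (f (of_real r))" for r
  proof -
    have "(\<lambda>j. Re (of_real (prob_mass M X j) * of_real r ^ j)) sums Re (f (of_real r))"
      using f by (intro sums_Re) (simp add: entire_pgf_def)
    then show ?thesis by (simp flip: of_real_power of_real_mult)
  qed
  then show ?thesis using lim by (rule that)
qed

text \<open>
  Choose \<open>b < \<beta>\<close> with \<open>1 / (4 b) < L / 2\<close>. Then the quotient of the shifted Euler coefficients by the
  lower bound \<open>exp (- j\<^sup>2 / (4 b) - j ln 2) / 2\<close> for \<open>p j\<close> is itself of Gaussian decay, hence bounded.
\<close>
lemma supercritical_perturbation_exists:
  fixes p :: "nat \<Rightarrow> real"
  assumes nonneg: "\<And>j. p j \<ge> 0" and sums: "\<And>r. (\<lambda>j. p j * r ^ j) sums F r"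
    and concave: "log_concave p"
    and lim: "((\<lambda>r. ln (F r) / (ln r)\<^sup>2) \<longlongrightarrow> \<beta>) at_top" and \<beta>: "\<beta> > 0"
    and a: "a > exp (1 / (2 * \<beta>))"
  shows "\<exists>h. perturbation (\<lambda>j. a ^ j) p h"
proof -
  define L where "L = ln a"
  have a1: "a > 1" using a \<beta> by (smt (verit) one_less_exp_iff divide_pos_pos)
  then have L: "L > 0" by (simp add: L_def)
  have "1 / (2 * \<beta>) < L" unfolding L_def using a a1 ln_less_cancel_iff[of "exp (1 / (2 * \<beta>))" a] by simp
  then have "1 / (2 * L) < \<beta>" using L \<beta> by (simp add: field_simps)
  then obtain b where b: "1 / (2 * L) < b" "b < \<beta>" using dense by blast
  have b0: "b > 0" using b L by (smt (verit) divide_pos_pos)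
  \<comment> \<open>\<open>- A i\<^sup>2 + B i + D\<close> is the exponent of the quotient at \<open>j = i + N\<close>, apart from \<open>ln 2\<close>.\<close>
  define A where "A = L / 2 - 1 / (4 * b)"
  have A: "A > 0" using b b0 L by (simp add: A_def field_simps)
  have "F r \<ge> 0" if "r \<ge> 0" for r
    using sums_le[OF _ sums_zero sums[of r]] nonneg that by simp
  then have growth: "\<forall>\<^sub>F r in at_top. exp (b * (ln r)\<^sup>2) \<le> F r"
    using pgf_growth_lower[OF _ lim b0 b(2)] by blast
  obtain N where N: "\<And>j. j \<ge> N \<Longrightarrow> exp (- (real j)\<^sup>2 / (4 * b) - ln 2 * real j) / 2 \<le> p j"
    using log_concave_mass_lower_bound[OF nonneg sums concave b0 growth] by blast
  define d where "d = ln a / 2 - ln (1 - 1 / a)"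
  define B where "B = d + real N / (2 * b) + ln 2"
  define D where "D = (real N)\<^sup>2 / (4 * b) + ln 2 * real N"
  define C where "C = 2 * exp ((B + 1)\<^sup>2 / (4 * A) + D)"
  define g where "g = (\<lambda>j. if j < N then 0 else euler_coeff a (j - N))"
  have "\<bar>g j\<bar> \<le> C * p j" for j
  proof (cases "j < N")
    case False
    then obtain i where i: "j = i + N" using le_Suc_ex by (metis add.commute not_less)
    have "\<bar>g j\<bar> \<le> exp (- (L / 2) * (real i)\<^sup>2 + d * real i)"
      using euler_coeff_bounds(2)[OF a1, of i] by (simp add: g_def i L_def d_def)
    also have "\<dots> = exp (- A * (real i)\<^sup>2 + B * real i) * exp (- (real j)\<^sup>2 / (4 * b) - ln 2 * real j) * exp D"
      unfolding exp_add[symmetric]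
      by (rule arg_cong[where f = exp])
         (use b0 in \<open>simp add: A_def B_def D_def i field_simps power2_eq_square\<close>)
    also have "\<dots> \<le> exp ((B + 1)\<^sup>2 / (4 * A)) * (2 * p j) * exp D"
    proof (intro mult_mono)
      have "exp (-1 :: real) ^ i \<le> 1" by (rule power_le_one) auto
      then have "exp ((B + 1)\<^sup>2 / (4 * A)) * exp (-1) ^ i \<le> exp ((B + 1)\<^sup>2 / (4 * A))"
        by (intro mult_left_le) auto
      then show "exp (- A * (real i)\<^sup>2 + B * real i) \<le> exp ((B + 1)\<^sup>2 / (4 * A))"
        by (rule order_trans[OF gaussian_term_le[OF A]])
      show "exp (- (real j)\<^sup>2 / (4 * b) - ln 2 * real j) \<le> 2 * p j" using N[of j] i by simp
    qed (use nonneg in auto)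
    also have "\<dots> = C * p j" by (simp add: C_def exp_add)
    finally show ?thesis .
  qed (simp add: g_def C_def nonneg)
  moreover have "(\<lambda>j. (a ^ j) ^ k * g j) sums 0" for k
    unfolding g_def by (rule euler_moments[OF a1])
  moreover have "g N \<noteq> 0" by (simp add: g_def)
  ultimately show ?thesis by (intro perturbation_exists[where g = g and C = C and i = N] nonneg)
qed

lemma real_Suc_choose_two: "real (Suc n choose 2) = real n * (real n + 1) / 2"
proof (induction n)
  case (Suc n)
  have "Suc (Suc n) choose 2 = Suc n + (Suc n choose 2)"
    by (simp add: numeral_2_eq_2)
  then show ?case using Suc by (simp add: field_simps)
qed (simp add: binomial_eq_0)

lemma power_Suc_choose_two:
  fixes a :: real
  assumes "a > 0"
  shows "a ^ (Suc n choose 2) = exp (ln a * (real n * (real n + 1) / 2))"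
  using exp_ln_power[OF assms, of "Suc n choose 2"] unfolding real_Suc_choose_two .

text \<open>
  Choose \<open>b > \<beta>\<close> with \<open>b L \<le> 1 / 2\<close>. Then \<open>F(a ^ n) \<le> exp (b n\<^sup>2 L\<^sup>2)\<close> is at most
  \<open>exp (L n\<^sup>2 / 2)\<close>, and dividing by \<open>exp (L n (n + 1) / 2)\<close> leaves a geometric sequence.
\<close>
lemma subcritical_no_perturbation:
  fixes p :: "nat \<Rightarrow> real"
  assumes nonneg: "\<And>j. p j \<ge> 0" and sums: "\<And>r. (\<lambda>j. p j * r ^ j) sums F r"
    and lim: "((\<lambda>r. ln (F r) / (ln r)\<^sup>2) \<longlongrightarrow> \<beta>) at_top" and \<beta>: "\<beta> > 0"
    and a1: "a > 1" and a: "a < exp (1 / (2 * \<beta>))"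
  shows "\<not> perturbation (\<lambda>j. a ^ j) p h"
proof -
  define L where "L = ln a"
  have L: "L > 0" using a1 by (simp add: L_def)
  have "L < 1 / (2 * \<beta>)" unfolding L_def using a a1 ln_less_cancel_iff[of a "exp (1 / (2 * \<beta>))"] by simp
  then have "\<beta> < 1 / (2 * L)" using L \<beta> by (simp add: field_simps)
  then obtain b where b: "\<beta> < b" "b < 1 / (2 * L)" using dense by blast
  have bL: "b * L \<le> 1 / 2" using b L by (simp add: field_simps)
  have term_eq: "(a ^ j) ^ k * p j = p j * (a ^ k) ^ j" for j k
    by (simp add: mult.commute flip: power_mult)
  have summable: "summable (\<lambda>j. (a ^ j) ^ k * p j)" for k
    unfolding term_eq by (rule sums_summable[OF sums])
  have "filterlim (\<lambda>n. a ^ n) at_top sequentially"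
    using a1 by real_asymp
  then have F_le: "\<forall>\<^sub>F n in sequentially. F (a ^ n) \<le> exp (b * (ln (a ^ n))\<^sup>2)"
    using pgf_growth_upper[OF lim b(1)] by (rule eventually_compose_filterlim[rotated])
  have tail_le: "(\<Sum>j. (a ^ (j + Suc n)) ^ n * p (j + Suc n)) \<le> F (a ^ n)" for n
  proof -
    have "F (a ^ n) = (\<Sum>j. (a ^ j) ^ n * p j)"
      unfolding term_eq by (rule sums_unique[OF sums])
    also have "\<dots> = (\<Sum>j. (a ^ (j + Suc n)) ^ n * p (j + Suc n)) + (\<Sum>j<Suc n. (a ^ j) ^ n * p j)"
      by (rule suminf_split_initial_segment[OF summable])
    moreover have "0 \<le> (\<Sum>j<Suc n. (a ^ j) ^ n * p j)"
      using a1 nonneg by (intro sum_nonneg mult_nonneg_nonneg) auto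
    ultimately show ?thesis by linarith
  qed
  have "(\<lambda>n. (\<Sum>j. (a ^ (j + Suc n)) ^ n * p (j + Suc n)) / a ^ (Suc n choose 2)) \<longlonglongrightarrow> 0"
  proof (rule tendsto_sandwich[OF _ _ tendsto_const])
    have "0 \<le> (\<Sum>j. (a ^ (j + Suc n)) ^ n * p (j + Suc n))" for n
      by (rule suminf_nonneg[OF summable_ignore_initial_segment[OF summable]]) (use a1 nonneg in simp)
    then show "\<forall>\<^sub>F n in sequentially.
        0 \<le> (\<Sum>j. (a ^ (j + Suc n)) ^ n * p (j + Suc n)) / a ^ (Suc n choose 2)"
      using a1 by (intro always_eventually allI divide_nonneg_nonneg) auto
    show "\<forall>\<^sub>F n in sequentially.
        (\<Sum>j. (a ^ (j + Suc n)) ^ n * p (j + Suc n)) / a ^ (Suc n choose 2) \<le> exp (- (L / 2)) ^ n"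
      using F_le
    proof eventually_elim
      case (elim n)
      have "b * (ln (a ^ n))\<^sup>2 = b * L * (L * (real n)\<^sup>2)"
        using a1 by (simp add: ln_realpow L_def power2_eq_square)
      also have "\<dots> \<le> 1 / 2 * (L * (real n)\<^sup>2)"
        using bL L by (intro mult_right_mono) auto
      finally have "b * (ln (a ^ n))\<^sup>2 \<le> real n * (- (L / 2)) + L * (real n * (real n + 1) / 2)"
        by (simp add: field_simps power2_eq_square)
      then have "exp (b * (ln (a ^ n))\<^sup>2) \<le> exp (- (L / 2)) ^ n * a ^ (Suc n choose 2)"
        using a1 unfolding exp_of_nat_mult[symmetric] L_def
        by (simp only: power_Suc_choose_two[of a] exp_add[symmetric] exp_le_cancel_iff)
      then have "(\<Sum>j. (a ^ (j + Suc n)) ^ n * p (j + Suc n)) \<le> exp (- (L / 2)) ^ n * a ^ (Suc n choose 2)"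
        using tail_le[of n] elim by linarith
      then show ?case using a1 by (simp add: pos_divide_le_eq)
    qed
    show "(\<lambda>n. exp (- (L / 2)) ^ n) \<longlonglongrightarrow> 0"
      using L by (intro LIMSEQ_realpow_zero) auto
  qed
  then show ?thesis by (rule no_perturbation_if_small_tail[OF a1 nonneg summable])
qed

text \<open>
  For \<open>p\<close> proportional to the absolute values of the Euler coefficients, domination holds with
  equality. The sequence is log-concave because the ratios \<open>a / (a ^ j - 1)\<close> decrease.
\<close>
lemma critical_with_perturbation:
  assumes a: "a > 1"
  shows "\<exists>(N :: nat measure) (Z :: nat \<Rightarrow> nat). log_concave_rv_with_limit N Z (1 / (2 * ln a)) \<and>
           (\<exists>h. perturbation (\<lambda>j. a ^ j) (prob_mass N Z) h)"
proof -
  define w where "w = (\<lambda>j. \<bar>euler_coeff a j\<bar>)"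
  define d where "d = ln a / 2 - ln (1 - 1 / a)"
  have L: "ln a > 0" using a by simp
  have "ln (1 - 1 / a) < 0" using a by (intro ln_less_zero) auto
  then have d: "d \<ge> 0" using L by (simp add: d_def)
  have "w j * w (j + 2) \<le> (w (j + 1))\<^sup>2" for j
  proof -
    have "1 < a ^ Suc j" using a by (intro one_less_power) auto
    moreover have "a ^ Suc j \<le> a ^ Suc (Suc j)" using a by (intro power_increasing) auto
    ultimately have "a / (a ^ Suc (Suc j) - 1) \<le> a / (a ^ Suc j - 1)"
      using a by (intro divide_left_mono mult_pos_pos) linarith+
    then have "w (Suc j) * w j * (a / (a ^ Suc (Suc j) - 1)) \<le> w (Suc j) * w j * (a / (a ^ Suc j - 1))"
      by (intro mult_left_mono) (auto simp: w_def)
    moreover have "w (j + 2) = a / (a ^ Suc (Suc j) - 1) * w (Suc j)"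
      unfolding w_def using abs_euler_coeff_Suc[OF a, of "Suc j"] by (simp del: power_Suc)
    moreover have "w (Suc j) = a / (a ^ Suc j - 1) * w j"
      unfolding w_def by (rule abs_euler_coeff_Suc[OF a])
    ultimately show ?thesis
      by (smt (verit) Suc_eq_plus1 mult.assoc mult.commute power2_eq_square)
  qed
  note concave = this
  obtain N :: "nat measure" and Z :: "nat \<Rightarrow> nat" and W
    where W: "W > 0" and N: "log_concave_rv_with_limit N Z (1 / (2 * ln a))"
      and mass: "prob_mass N Z = (\<lambda>j. w j / W)"
    by (rule log_concave_rv_from_weights[OF L d _ _ concave])
       (use euler_coeff_bounds[OF a] in \<open>simp_all add: w_def d_def\<close>)
  have "\<exists>h. perturbation (\<lambda>j. a ^ j) (prob_mass N Z) h"
  proof (rule perturbation_exists[where g = "\<lambda>j. euler_coeff a j / W" and C = 1 and i = 0])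
    show "(\<lambda>j. (a ^ j) ^ k * (euler_coeff a j / W)) sums 0" for k
      using sums_divide[OF euler_moments[OF a, of k 0], of W] by simp
  qed (use W in \<open>simp_all add: mass w_def abs_divide\<close>)
  with N show ?thesis by blast
qed

text \<open>
  For weights \<open>a ^ (- j (j + 1) / 2)\<close> the exponents of the tail complete to a square: with
  \<open>i = j - n\<close>, the quotient of the \<open>j\<close>-th term by \<open>a ^ (n (n + 1) / 2)\<close> is \<open>a ^ (- i (i - 1) / 2 - j)\<close>,
  and the factor \<open>a ^ (- j)\<close> makes the tail beyond \<open>n\<close> vanish in the limit.
\<close>
lemma critical_without_perturbation:
  assumes a: "a > 1"
  shows "\<exists>(N :: nat measure) (Z :: nat \<Rightarrow> nat). log_concave_rv_with_limit N Z (1 / (2 * ln a)) \<and>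
           \<not> (\<exists>h. perturbation (\<lambda>j. a ^ j) (prob_mass N Z) h)"
proof -
  define L where "L = ln a"
  have L: "L > 0" using a by (simp add: L_def)
  then have d: "L / 2 \<ge> 0" by simp
  define w where "w = (\<lambda>j. exp (- (L / 2) * (real j)\<^sup>2 - L / 2 * real j))"
  have concave: "w j * w (j + 2) \<le> (w (j + 1))\<^sup>2" for j
    using L unfolding w_def power2_eq_square exp_add[symmetric] exp_le_cancel_iff
    by (simp add: field_simps)
  have w_upper: "w j \<le> exp (- (L / 2) * (real j)\<^sup>2 + L / 2 * real j)" for j
    using L by (simp add: w_def)
  obtain N :: "nat measure" and Z :: "nat \<Rightarrow> nat" and W
    where W: "W > 0" and N: "log_concave_rv_with_limit N Z (1 / (2 * L))"
      and mass: "prob_mass N Z = (\<lambda>j. w j / W)"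
    by (rule log_concave_rv_from_weights[OF L d _ w_upper concave]) (simp_all add: w_def)
  have w_summable: "summable (\<lambda>j. (a ^ j) ^ k * w j)" for k
  proof -
    have "summable (\<lambda>j. \<bar>w j\<bar> * (a ^ k) ^ j)"
      by (rule gaussian_series_bound(1)[where c = "L / 2" and d = "L / 2"])
         (use L a w_upper in \<open>simp_all add: w_def\<close>)
    moreover have "\<bar>w j\<bar> * (a ^ k) ^ j = (a ^ j) ^ k * w j" for j
      by (simp add: w_def mult.commute flip: power_mult)
    ultimately show ?thesis by simp
  qed
  have term_le: "(a ^ j) ^ n * w j / a ^ (Suc n choose 2) \<le> (1 / a) ^ j" if "j > n" for j n
  proof -
    have "0 \<le> L / 2 * ((real j - real n) * (real j - real n - 1))"
      using L that by (intro mult_nonneg_nonneg) auto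
    then have le: "L * real (j * n) + (- (L / 2) * (real j)\<^sup>2 - L / 2 * real j) + L * real j \<le>
        L * (real n * (real n + 1) / 2)"
      by (simp add: algebra_simps power2_eq_square)
    have "(a ^ j) ^ n = exp (L * real (j * n))" "a ^ j = exp (L * real j)"
      using a exp_ln_power[of a "j * n"] exp_ln_power[of a j]
      by (simp_all only: L_def power_mult)
    then have "(a ^ j) ^ n * w j * a ^ j =
        exp (L * real (j * n) + (- (L / 2) * (real j)\<^sup>2 - L / 2 * real j) + L * real j)"
      by (simp only: exp_add w_def)
    also have "\<dots> \<le> a ^ (Suc n choose 2)"
      using le a by (simp only: power_Suc_choose_two[of a] L_def exp_le_cancel_iff)
    finally show ?thesis using a by (simp add: power_one_over field_simps)
  qed
  have mass_summable: "summable (\<lambda>j. (a ^ j) ^ k * (w j / W))" for k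
    using summable_divide[OF w_summable[of k], of W] by simp
  have tail_le: "(\<Sum>j. (a ^ (j + Suc n)) ^ n * (w (j + Suc n) / W)) / a ^ (Suc n choose 2) \<le>
      (1 / a) ^ n * (1 / (1 - 1 / a) / W)" for n
  proof -
    have "(\<lambda>j. (1 / a) ^ Suc n * (1 / a) ^ j / W) sums ((1 / a) ^ Suc n * (1 / (1 - 1 / a)) / W)"
      using a by (intro sums_divide sums_mult geometric_sums) auto
    then have geometric: "(\<lambda>j. (1 / a) ^ (j + Suc n) / W) sums ((1 / a) ^ Suc n * (1 / (1 - 1 / a)) / W)"
      by (simp add: power_add mult.commute)
    have "(\<Sum>j. (a ^ (j + Suc n)) ^ n * (w (j + Suc n) / W)) / a ^ (Suc n choose 2) =
        (\<Sum>j. (a ^ (j + Suc n)) ^ n * (w (j + Suc n) / W) / a ^ (Suc n choose 2))"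
      by (rule suminf_divide[OF summable_ignore_initial_segment[OF mass_summable], symmetric])
    also have "\<dots> \<le> (\<Sum>j. (1 / a) ^ (j + Suc n) / W)"
    proof (rule suminf_le)
      fix j
      show "(a ^ (j + Suc n)) ^ n * (w (j + Suc n) / W) / a ^ (Suc n choose 2) \<le> (1 / a) ^ (j + Suc n) / W"
        using divide_right_mono[OF term_le[of n "j + Suc n"], of W] W
        by (simp add: mult.commute)
    qed (use summable_divide[OF summable_ignore_initial_segment[OF mass_summable]]
          sums_summable[OF geometric] in blast)+
    also have "\<dots> = (1 / a) ^ Suc n * (1 / (1 - 1 / a)) / W"
      by (rule sums_unique[OF geometric, symmetric])
    also have "\<dots> = (1 / a) ^ Suc n * (1 / (1 - 1 / a) / W)" by simp
    also have "\<dots> \<le> (1 / a) ^ n * (1 / (1 - 1 / a) / W)"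
      using a W by (intro mult_right_mono power_decreasing) auto
    finally show ?thesis .
  qed
  have "(\<lambda>n. (\<Sum>j. (a ^ (j + Suc n)) ^ n * (w (j + Suc n) / W)) / a ^ (Suc n choose 2)) \<longlonglongrightarrow> 0"
  proof (rule tendsto_sandwich[OF _ always_eventually[OF allI[OF tail_le]] tendsto_const])
    have "0 \<le> (\<Sum>j. (a ^ (j + Suc n)) ^ n * (w (j + Suc n) / W))" for n
      by (rule suminf_nonneg[OF summable_ignore_initial_segment[OF mass_summable]])
         (use a W in \<open>simp add: w_def\<close>)
    then show "\<forall>\<^sub>F n in sequentially.
        0 \<le> (\<Sum>j. (a ^ (j + Suc n)) ^ n * (w (j + Suc n) / W)) / a ^ (Suc n choose 2)"
      using a by (intro always_eventually allI divide_nonneg_nonneg) auto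
    show "(\<lambda>n. (1 / a) ^ n * (1 / (1 - 1 / a) / W)) \<longlonglongrightarrow> 0"
      using a by (intro tendsto_mult_left_zero LIMSEQ_realpow_zero) auto
  qed
  then have "\<not> perturbation (\<lambda>j. a ^ j) (prob_mass N Z) h" for h
    unfolding mass
    by (intro no_perturbation_if_small_tail[OF a _ mass_summable])
       (use W in \<open>simp_all add: w_def\<close>)
  with N show ?thesis unfolding L_def by blast
qed

theorem theorem2p4:
  fixes M :: "'w measure" and X :: "'w \<Rightarrow> nat" and \<beta> a :: real
  assumes "log_concave_rv_with_limit M X \<beta>"
    and "a > 1"
  shows "(a > exp (1 / (2 * \<beta>)) \<longrightarrow>
            has_stieltjes_classes M (\<lambda>\<omega>. a ^ X \<omega>) (\<lambda>j. a ^ j)) \<and>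
         (a < exp (1 / (2 * \<beta>)) \<longrightarrow>
            \<not> has_stieltjes_classes M (\<lambda>\<omega>. a ^ X \<omega>) (\<lambda>j. a ^ j)) \<and>
         (a = exp (1 / (2 * \<beta>)) \<longrightarrow>
            (\<exists>(N :: nat measure) (Z :: nat \<Rightarrow> nat). log_concave_rv_with_limit N Z \<beta> \<and>
               has_stieltjes_classes N (\<lambda>\<omega>. a ^ Z \<omega>) (\<lambda>j. a ^ j)) \<and>
            (\<exists>(N :: nat measure) (Z :: nat \<Rightarrow> nat). log_concave_rv_with_limit N Z \<beta> \<and>
               \<not> has_stieltjes_classes N (\<lambda>\<omega>. a ^ Z \<omega>) (\<lambda>j. a ^ j)))"
proof -
  note iff = has_stieltjes_classes_power_iff[OF assms(2)]
  have concave: "log_concave (prob_mass M X)" and \<beta>: "\<beta> > 0"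
    using assms(1) by (auto simp: log_concave_rv_with_limit_def)
  have nonneg: "prob_mass M X j \<ge> 0" for j by (simp add: prob_mass_def)
  obtain F where sums: "\<And>r. (\<lambda>j. prob_mass M X j * r ^ j) sums F r"
    and lim: "((\<lambda>r. ln (F r) / (ln r)\<^sup>2) \<longlongrightarrow> \<beta>) at_top"
    using log_concave_rv_with_limit_pgf[OF assms(1)] by blast
  have critical: "\<beta> = 1 / (2 * ln a)" if "a = exp (1 / (2 * \<beta>))"
    using that \<beta> by simp
  show ?thesis
    unfolding iff
    using supercritical_perturbation_exists[OF nonneg sums concave lim \<beta>]
      subcritical_no_perturbation[OF nonneg sums lim \<beta> assms(2)]
      critical_with_perturbation[OF assms(2)] critical_without_perturbation[OF assms(2)]
    by (metis critical)
qed

end
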